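(* (SSC inequality for constrained problems.) Consider the problem $\min_{\mathbf w\in\mathcal W}\{f(\mathbf w)=h(X\mathbf w)+\mathbf q^T\mathbf w\}$, with optimal solution set $\mathcal W_c^\star$ and optimal value $f^\star$. Under assumptions A1, A2, A3 (stated in the context), the problem satisfies the semi-strongly convex (SSC) inequality with the constant $$\beta=\frac{1}{\theta^2\left(\frac{1+2\|\nabla h(\mathbf r^\star)\|^2}{\mu}+M\right)}>0,$$ that is, for any finite $\mathbf w\in\mathcal W$, $$f(\mathbf w)-f^\star\ge\frac\beta2\left\|\mathbf w-\Pi_{\mathcal W_c^\star}(\mathbf w)\right\|^2.$$ Here $\theta>0$ is the Hoffman constant of $\mathcal W_c^\star$ (defined in the context); $\mu>0$ is the strong convexity modulus of $h$ in some convex compact set; $M>0$ is an upper bound of $f(\mathbf w)-f^\star$ for any $\mathbf w\in\mathcal W$; and $\mathbf r^\star$ is the constant vector such that $X\mathbf w^\star=\mathbf r^\star$ for all $\mathbf w^\star\in\mathcal W_c^\star$.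
   Context: Norms are Euclidean; $\Pi_S$ is Euclidean projection onto $S$; $X\in\mathbb R^{n\times d}$, $\mathbf w,\mathbf q\in\mathbb R^d$. A1: $f(\mathbf w)=\frac1n\sum_{i=1}^n f_i(\mathbf w)$ is the average of $n$ convex components $f_i$, where $\nabla f$ and $\nabla f_i$ are Lipschitz continuous on $\mathbb R^d$ with constants $L$ and $L_i$, respectively. A2: The effective domain $\mathrm{dom}(h)$ of $h$ is open and non-empty; $h$ is continuously differentiable on $\mathrm{dom}(h)$ and strongly convex on any convex compact subset of $\mathrm{dom}(h)$. (Strong convexity on $\mathcal U$ with modulus $\mu>0$ means $h(\mathbf a)\ge h(\mathbf b)+\nabla h(\mathbf b)^T(\mathbf a-\mathbf b)+\frac\mu2\|\mathbf a-\mathbf b\|^2$ for all $\mathbf a,\mathbf b\in\mathcal U$.) A3: The constraint set is polyhedral, $\mathcal W=\{\mathbf w\in\mathbb R^d:C\mathbf w\le\mathbf b\}$ for some $C\in\mathbb R^{l\times d}$, $\mathbf b\in\mathbb R^l$; and the optimal solution set $\mathcal W_c^\star$ is non-empty. Under A1–A3 there exist unique $\mathbf r^\star\in\mathbb R^n$ and $s^\star\in\mathbb R$ such that $X\mathbf w^\star=\mathbf r^\star$ and $\mathbf q^T\mathbf w^\star=s^\star$ for all $\mathbf w^\star\in\mathcal W_c^\star$, and $\mathcal W_c^\star=\{\mathbf w:C\mathbf w\le\mathbf b,\ X\mathbf w=\mathbf r^\star,\ \mathbf q^T\mathbf w=s^\star\}$. Hoffman constant: for a non-empty polyhedron $\{\mathbf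 w:C\mathbf w\le\mathbf b,\ A\mathbf w=\mathbf a\}$ it is $\theta=\sup_{\mathbf u,\mathbf v}\|(\mathbf u,\mathbf v)\|$ over all $\mathbf u\ge0$, $\mathbf v$ with $\|C^T\mathbf u+A^T\mathbf v\|=1$ such that the rows of $C$ and $A$ corresponding to the nonzero components of $\mathbf u$ and $\mathbf v$ are linearly independent; it is finite, and every $\mathbf w\in\mathbb R^d$ has a point $\mathbf w^\star$ of the polyhedron with $\|\mathbf w-\mathbf w^\star\|^2\le\theta^2(\|[C\mathbf w-\mathbf b]^+\|^2+\|A\mathbf w-\mathbf a\|^2)$, where $[\cdot]^+$ is projection onto the non-negative orthant. For $\mathcal W_c^\star$, the equality rows $A$ are the rows of $X$ together with $\mathbf q^T$, and $\mathbf a=(\mathbf r^\star,s^\star)$. *)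

theory Defs
  imports "HOL-Analysis.Analysis"
begin

definition gradient :: "('a::real_inner \<Rightarrow> real) \<Rightarrow> 'a \<Rightarrow> 'a" where
  "gradient F x = (THE D. GDERIV F x :> D)"

definition lipschitz_gradient :: "real \<Rightarrow> ('a::euclidean_space \<Rightarrow> real) \<Rightarrow> bool" where
  "lipschitz_gradient L F \<longleftrightarrow>
     (\<forall>x. F differentiable (at x)) \<and> L-lipschitz_on UNIV (gradient F)"

definition strongly_convex_on :: "'a::euclidean_space set \<Rightarrow> ('a \<Rightarrow> real) \<Rightarrow> real \<Rightarrow> bool" where
  "strongly_convex_on U F \<mu> \<longleftrightarrow> \<mu> > 0 \<and>
     (\<forall>a\<in>U. \<forall>b\<in>U. F a \<ge> F b + gradient F b \<bullet> (a - b) + \<mu> / 2 * (norm (a - b))\<^sup>2)"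

definition effective_domain :: "('a \<Rightarrow> ereal) \<Rightarrow> 'a set" where
  "effective_domain h = {x. h x < \<infinity>}"

definition smooth_convex_average ::
  "('a::euclidean_space \<Rightarrow> real) \<Rightarrow> ('n::finite \<Rightarrow> 'a \<Rightarrow> real) \<Rightarrow> real \<Rightarrow> ('n \<Rightarrow> real) \<Rightarrow> bool" where
  "smooth_convex_average f fs L Ls \<longleftrightarrow>
     (\<forall>w. f w = (\<Sum>i\<in>UNIV. fs i w) / real CARD('n)) \<and>
     (\<forall>i. convex_on UNIV (fs i)) \<and>
     lipschitz_gradient L f \<and>
     (\<forall>i. lipschitz_gradient (Ls i) (fs i))"

(* Values range over (-infinity, infinity], as usual in convex analysis; on the effective
   domain h is therefore real-valued and differentiation refers to its real part. *)
definition locally_strongly_convex :: "('a::euclidean_space \<Rightarrow> ereal) \<Rightarrow> bool" where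
  "locally_strongly_convex h \<longleftrightarrow>
     (\<forall>x. h x \<noteq> -\<infinity>) \<and>
     open (effective_domain h) \<and> effective_domain h \<noteq> {} \<and>
     (\<forall>x\<in>effective_domain h. (\<lambda>y. real_of_ereal (h y)) differentiable (at x)) \<and>
     continuous_on (effective_domain h) (gradient (\<lambda>y. real_of_ereal (h y))) \<and>
     (\<forall>U. convex U \<and> compact U \<and> U \<subseteq> effective_domain h \<longrightarrow>
        (\<exists>\<mu>. strongly_convex_on U (\<lambda>y. real_of_ereal (h y)) \<mu>))"

definition polyhedral_set :: "real^'d^'l \<Rightarrow> real^'l \<Rightarrow> (real^'d) set" where
  "polyhedral_set C b = {w. C *v w \<le> b}"

definition solution_set :: "('a \<Rightarrow> real) \<Rightarrow> 'a set \<Rightarrow> 'a set" where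
  "solution_set f W = {w. is_arg_min f (\<lambda>v. v \<in> W) w}"

definition append_row :: "real^'d^'n \<Rightarrow> real^'d \<Rightarrow> real^'d^('n option)" where
  "append_row X q = (\<chi> k. case k of None \<Rightarrow> q | Some i \<Rightarrow> X $ i)"

(* Independence is that of the indexed family of rows, so two equal rows at different
   positions count as dependent; this is the role of inj_on. *)
definition selected_rows_independent ::
  "real^'d^'l \<Rightarrow> real^'d^'m \<Rightarrow> real^'l \<Rightarrow> real^'m \<Rightarrow> bool" where
  "selected_rows_independent C A u v \<longleftrightarrow>
     (let S = Inl ` {i. u $ i \<noteq> 0} \<union> Inr ` {j. v $ j \<noteq> 0};
          r = case_sum (\<lambda>i. C $ i) (\<lambda>j. A $ j)
      in inj_on r S \<and> independent (r ` S))"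

(* The right-hand sides of the system C w \<le> b, A w = a do not enter.
   The supremum is over a nonempty set unless C = 0 and A = 0. *)
definition hoffman_constant :: "real^'d^'l \<Rightarrow> real^'d^'m \<Rightarrow> real" where
  "hoffman_constant C A =
     Sup {norm (u, v) | u v. 0 \<le> u \<and> norm (transpose C *v u + transpose A *v v) = 1 \<and>
                             selected_rows_independent C A u v}"

end

theory Submission
  imports Defs
begin

text \<open>
  Two ingredients combine. The first is Hoffman's error bound: the distance of a feasible point to the
  optimal set is at most \<^term>\<open>\<theta>\<close> times its violation of the two equations that cut the optimal set
  out of the feasible polyhedron, one fixing the image under \<^term>\<open>X\<close> and one fixing the value of
  the linear form \<^term>\<open>q\<close>. The projection residual is normal to the optimal set, so Farkas' lemma
  writes it as a combination of active rows; an exchange argument makes these rows independent, and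
  the definition of the Hoffman constant then bounds the multipliers
  (\<open>farkas\<close>, \<open>sign_preserving_independent_support\<close>, \<open>hoffman_error_bound\<close>).

  The second is that the optimality gap \<open>\<Delta>\<close> at a feasible point controls both violations. Strong
  convexity of \<open>h\<close> and first-order optimality give \<open>G + \<mu>/2 R\<^sup>2 \<le> \<Delta>\<close>, where \<open>R\<close> is the violation of
  the first equation and \<open>G \<ge> 0\<close> is the directional derivative at the optimal point
  (\<open>strongly_convex_composite_growth\<close>). Hence \<open>R\<^sup>2 \<le> 2\<Delta>/\<mu>\<close>. The violation of the second equation
  is \<open>G\<close> minus the inner product of the gradient of \<open>h\<close> with the image difference, so its square is
  at most twice \<open>G\<^sup>2\<close> plus twice the squared gradient norm times \<open>R\<^sup>2\<close>. Finally \<open>G\<^sup>2 \<le> \<Delta> M\<close>, and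
  the sum of these bounds is the constant in the theorem (\<open>residual_bound\<close>).

  A compact convex set on which \<open>h\<close> is strongly convex and which contains the image of the feasible
  polyhedron exists because the objective is bounded there by the gap bound \<open>M\<close>, while growth by
  a fixed amount near the optimum propagates linearly by convexity
  (\<open>bounded_image_of_bounded_values\<close>).
\<close>

section \<open>Independent supports of linear combinations\<close>

lemma indexed_family_independent_iff:
  fixes r :: "'i \<Rightarrow> 'a::real_vector"
  assumes "finite S"
  shows "inj_on r S \<and> independent (r ` S) \<longleftrightarrow>
    (\<forall>e. (\<Sum>i\<in>S. e i *\<^sub>R r i) = 0 \<longrightarrow> (\<forall>i\<in>S. e i = 0))"
proof (intro iffI allI impI ballI)
  fix e i
  assume ind: "inj_on r S \<and> independent (r ` S)" and e: "(\<Sum>i\<in>S. e i *\<^sub>R r i) = 0" and i: "i \<in> S"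
  let ?u = "\<lambda>v. e (inv_into S r v)"
  have inj: "inj_on r S" using ind ..
  have "(\<Sum>v\<in>r ` S. ?u v *\<^sub>R v) = (\<Sum>i\<in>S. ?u (r i) *\<^sub>R r i)"
    by (simp only: sum.reindex[OF inj] o_def)
  also have "\<dots> = (\<Sum>i\<in>S. e i *\<^sub>R r i)"
    by (rule sum.cong) (simp_all add: inj)
  finally have 0: "(\<Sum>v\<in>r ` S. ?u v *\<^sub>R v) = 0" by (simp only: e)
  have "?u (r i) = 0"
  proof (rule ccontr)
    assume "?u (r i) \<noteq> 0"
    with i 0 have "dependent (r ` S)"
      unfolding dependent_finite[OF finite_imageI[OF assms]] by (intro exI[of _ ?u] conjI bexI) auto
    then show False using ind by simp
  qed
  then show "e i = 0" using inj i by simp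
next
  assume R: "\<forall>e. (\<Sum>i\<in>S. e i *\<^sub>R r i) = 0 \<longrightarrow> (\<forall>i\<in>S. e i = 0)"
  have inj: "inj_on r S"
  proof (rule inj_onI, rule ccontr)
    fix i j assume ij: "i \<in> S" "j \<in> S" "r i = r j" "i \<noteq> j"
    let ?e = "\<lambda>k. (if k = i then 1 else 0) - (if k = j then 1 else 0) :: real"
    have "(\<Sum>k\<in>S. ?e k *\<^sub>R r k) = (\<Sum>k\<in>S. if k = i then r k else 0) - (\<Sum>k\<in>S. if k = j then r k else 0)"
      by (subst sum_subtractf[symmetric], rule sum.cong) auto
    also have "\<dots> = 0" using ij assms by simp
    finally have "?e i = 0" using R[THEN spec, of ?e] ij(1) by blast
    then show False using ij by simp
  qed
  have "independent (r ` S)"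
  proof (rule ccontr)
    assume "\<not> independent (r ` S)"
    then obtain u where u: "\<exists>v\<in>r ` S. u v \<noteq> 0" "(\<Sum>v\<in>r ` S. u v *\<^sub>R v) = 0"
      by (simp only: dependent_finite[OF finite_imageI[OF assms]] not_not) blast
    from u(2) have "(\<Sum>i\<in>S. u (r i) *\<^sub>R r i) = 0" by (simp only: sum.reindex[OF inj] o_def)
    then have "\<forall>i\<in>S. u (r i) = 0" using R[THEN spec, of "\<lambda>i. u (r i)"] by blast
    with u(1) show False by blast
  qed
  with inj show "inj_on r S \<and> independent (r ` S)" ..
qed

text \<open>This is Caratheodory's theorem for conic combinations, in a form that serves constrained and
  free coefficients alike: along a linear dependency of the rows in use, a coefficient is moved to
  zero without any other coefficient changing sign, which removes one row.\<close>

lemma sign_preserving_independent_support: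
  fixes r :: "'i::finite \<Rightarrow> 'a::real_vector" and c :: "'i \<Rightarrow> real"
  shows "\<exists>c'. (\<Sum>i\<in>UNIV. c' i *\<^sub>R r i) = (\<Sum>i\<in>UNIV. c i *\<^sub>R r i) \<and>
    (\<forall>i. 0 \<le> c i \<longrightarrow> 0 \<le> c' i) \<and> (\<forall>i. c i = 0 \<longrightarrow> c' i = 0) \<and>
    inj_on r {i. c' i \<noteq> 0} \<and> independent (r ` {i. c' i \<noteq> 0})"
proof (induction "card {i. c i \<noteq> 0}" arbitrary: c rule: less_induct)
  case less
  show ?case
  proof (cases "inj_on r {i. c i \<noteq> 0} \<and> independent (r ` {i. c i \<noteq> 0})")
    case True
    then show ?thesis by blast
  next
    case False
    then obtain e0 where e0: "(\<Sum>i\<in>{i. c i \<noteq> 0}. e0 i *\<^sub>R r i) = 0" "\<exists>i. c i \<noteq> 0 \<and> e0 i \<noteq> 0"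
      by (subst (asm) indexed_family_independent_iff) auto
    define e where "e i = (if c i = 0 then 0 else e0 i)" for i
    have "(\<Sum>i\<in>UNIV. e i *\<^sub>R r i) = (\<Sum>i\<in>{i. c i \<noteq> 0}. e0 i *\<^sub>R r i)"
      unfolding e_def by (rule sum.mono_neutral_cong_right) auto
    with e0 have e: "(\<Sum>i\<in>UNIV. e i *\<^sub>R r i) = 0" by simp
    \<comment> \<open>The index with the smallest ratio is the first to reach zero, so no sign changes before it.\<close>
    define k where "k = arg_min_on (\<lambda>i. \<bar>c i / e i\<bar>) {i. e i \<noteq> 0}"
    have ne: "{i. e i \<noteq> 0} \<noteq> {}" using e0(2) by (auto simp: e_def)
    have k: "e k \<noteq> 0" "\<And>i. e i \<noteq> 0 \<Longrightarrow> \<bar>c k / e k\<bar> \<le> \<bar>c i / e i\<bar>"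
      using arg_min_if_finite(1)[OF _ ne, of "\<lambda>i. \<bar>c i / e i\<bar>"]
        arg_min_least[OF _ ne, of _ "\<lambda>i. \<bar>c i / e i\<bar>"] by (auto simp: k_def)
    define t where "t = c k / e k"
    have small: "\<bar>t * e i\<bar> \<le> \<bar>c i\<bar>" for i
    proof (cases "e i = 0")
      case False
      then have "\<bar>t\<bar> * \<bar>e i\<bar> \<le> \<bar>c i / e i\<bar> * \<bar>e i\<bar>"
        using k(2)[of i] by (intro mult_right_mono) (auto simp: t_def)
      then show ?thesis using False by (simp add: abs_mult)
    qed simp
    define d where "d i = c i - t * e i" for i
    have d_pos: "0 \<le> d i" if "0 \<le> c i" for i using small[of i] that by (auto simp: d_def)
    have d_0: "d i = 0" if "c i = 0" for i using small[of i] that by (auto simp: d_def)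
    have "c k \<noteq> 0" "d k = 0" using k(1) by (auto simp: e_def t_def d_def split: if_splits)
    then have "{i. d i \<noteq> 0} \<subset> {i. c i \<noteq> 0}" using d_0 by auto
    then have card: "card {i. d i \<noteq> 0} < card {i. c i \<noteq> 0}" by (simp add: psubset_card_mono)
    have "(\<Sum>i\<in>UNIV. d i *\<^sub>R r i) = (\<Sum>i\<in>UNIV. c i *\<^sub>R r i) - t *\<^sub>R (\<Sum>i\<in>UNIV. e i *\<^sub>R r i)"
      by (simp add: d_def scaleR_diff_left sum_subtractf scaleR_sum_right)
    then have "(\<Sum>i\<in>UNIV. d i *\<^sub>R r i) = (\<Sum>i\<in>UNIV. c i *\<^sub>R r i)" using e by simp
    moreover obtain c' where c': "(\<Sum>i\<in>UNIV. c' i *\<^sub>R r i) = (\<Sum>i\<in>UNIV. d i *\<^sub>R r i)"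
      "\<forall>i. 0 \<le> d i \<longrightarrow> 0 \<le> c' i" "\<forall>i. d i = 0 \<longrightarrow> c' i = 0"
      "inj_on r {i. c' i \<noteq> 0}" "independent (r ` {i. c' i \<noteq> 0})"
      using less[OF card] by auto
    ultimately show ?thesis using d_pos d_0 by (intro exI[of _ c']) simp
  qed
qed

section \<open>Finitely generated cones\<close>

text \<open>Farkas' lemma, for inequality rows \<^term>\<open>N\<close> and equality rows \<^term>\<open>F\<close>. The cone generated by
  finitely many vectors is closed, so a vector \<^term>\<open>g\<close> outside it is separated from it by a
  hyperplane, whose normal direction contradicts the polarity hypothesis. An equality row enters
  the cone with both signs.\<close>

lemma farkas:
  fixes r :: "'i::finite \<Rightarrow> 'a::euclidean_space"
  assumes disj: "N \<inter> F = {}"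
    and polar: "\<And>d. (\<forall>i\<in>N. r i \<bullet> d \<le> 0) \<Longrightarrow> (\<forall>i\<in>F. r i \<bullet> d = 0) \<Longrightarrow> g \<bullet> d \<le> 0"
  obtains c where "g = (\<Sum>i\<in>UNIV. c i *\<^sub>R r i)" "\<And>i. i \<in> N \<Longrightarrow> 0 \<le> c i"
    "\<And>i. i \<notin> N \<union> F \<Longrightarrow> c i = 0"
proof -
  define B where "B = r ` (N \<union> F) \<union> (\<lambda>i. - r i) ` F"
  define Q where "Q = convex_cone hull B"
  define comb where "comb c = (\<Sum>i\<in>UNIV. c i *\<^sub>R r i)" for c
  define T where "T = {c. (\<forall>i\<in>N. 0 \<le> c i) \<and> (\<forall>i. i \<notin> N \<union> F \<longrightarrow> c i = (0::real))}"
  have cone: "convex_cone Q" unfolding Q_def by (rule convex_cone_convex_cone_hull)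
  have "g \<in> Q"
  proof (rule ccontr)
    assume "g \<notin> Q"
    moreover have "closed Q" unfolding Q_def by (rule closed_convex_cone_hull) (simp add: B_def)
    moreover have "convex Q" using cone by (simp add: convex_cone_def)
    ultimately obtain a \<beta> where a: "a \<bullet> g < \<beta>" "\<And>x. x \<in> Q \<Longrightarrow> \<beta> < a \<bullet> x"
      by (metis separating_hyperplane_closed_point)
    have "\<beta> < 0" using a(2)[OF convex_cone_contains_0[OF cone]] by simp
    have nonneg: "0 \<le> a \<bullet> x" if x: "x \<in> Q" for x
    proof (rule ccontr)
      assume neg: "\<not> 0 \<le> a \<bullet> x"
      then have "(\<beta> / (a \<bullet> x)) *\<^sub>R x \<in> Q"
        using convex_cone_scaleR[OF cone _ x] \<open>\<beta> < 0\<close> by (simp add: divide_nonpos_neg)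
      \<comment> \<open>Scaling the point brings it exactly onto the separating hyperplane.\<close>
      from a(2)[OF this] neg show False by simp
    qed
    have "B \<subseteq> Q" unfolding Q_def by (rule hull_subset)
    then have Q: "r i \<in> Q" if "i \<in> N \<union> F" for i
      using that by (auto simp: B_def)
    from \<open>B \<subseteq> Q\<close> have Q': "- r i \<in> Q" if "i \<in> F" for i
      using that by (auto simp: B_def)
    have "\<forall>i\<in>N. r i \<bullet> (- a) \<le> 0"
      using nonneg[OF Q] by (simp add: inner_commute)
    moreover have "\<forall>i\<in>F. r i \<bullet> (- a) = 0"
    proof
      fix i assume "i \<in> F"
      then show "r i \<bullet> (- a) = 0"
        using nonneg[OF Q, of i] nonneg[OF Q', of i] by (simp add: inner_commute)
    qed
    ultimately have "g \<bullet> (- a) \<le> 0" by (rule polar)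
    then show False using a(1) \<open>\<beta> < 0\<close> by (simp add: inner_commute)
  qed
  moreover have "Q \<subseteq> comb ` T"
    unfolding Q_def
  proof (rule hull_minimal)
    have single: "(\<Sum>i\<in>UNIV. (if i = k then s else 0) *\<^sub>R r i) = s *\<^sub>R r k" for k s
      by (subst sum.remove[of _ k]) auto
    show "B \<subseteq> comb ` T"
    proof
      fix x assume "x \<in> B"
      then consider k where "k \<in> N \<union> F" "x = r k" | k where "k \<in> F" "x = - r k"
        by (auto simp: B_def)
      then show "x \<in> comb ` T"
      proof cases
        case 1
        then show ?thesis using single[of k 1]
          by (intro image_eqI[of _ _ "\<lambda>i. if i = k then 1 else 0"]) (auto simp: comb_def T_def)
      next
        case 2
        then show ?thesis using single[of k "-1"] disj
          by (intro image_eqI[of _ _ "\<lambda>i. if i = k then -1 else 0"]) (auto simp: comb_def T_def)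
      qed
    qed
    have add: "comb c + comb d = comb (\<lambda>i. c i + d i)" for c d
      by (simp add: comb_def scaleR_add_left sum.distrib)
    have scale: "s *\<^sub>R comb c = comb (\<lambda>i. s * c i)" for s c
      by (simp add: comb_def scaleR_sum_right)
    show "convex_cone (comb ` T)"
      unfolding convex_cone_iff
    proof (intro conjI ballI allI impI)
      show "0 \<in> comb ` T" by (rule image_eqI[of _ comb "\<lambda>i. 0"]) (simp_all add: comb_def T_def)
    next
      fix x y assume "x \<in> comb ` T" "y \<in> comb ` T"
      then obtain c d where "c \<in> T" "d \<in> T" "x = comb c" "y = comb d" by blast
      then show "x + y \<in> comb ` T"
        by (intro image_eqI[of _ _ "\<lambda>i. c i + d i"]) (simp_all add: add T_def)
    next
      fix x and s :: real assume "x \<in> comb ` T" "0 \<le> s"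
      then obtain c where "c \<in> T" "x = comb c" by blast
      with \<open>0 \<le> s\<close> show "s *\<^sub>R x \<in> comb ` T"
        by (intro image_eqI[of _ _ "\<lambda>i. s * c i"]) (simp_all add: scale T_def)
    qed
  qed
  ultimately obtain c where "c \<in> T" "g = comb c" by blast
  then show thesis using that[of c] by (simp add: T_def comb_def)
qed

section \<open>Hoffman's error bound\<close>

text \<open>The rows of both matrices form a single family over the disjoint sum of the index types, so that
  the results on indexed families apply to the inequality and equality rows together.\<close>

definition stacked_rows :: "real^'d^'l \<Rightarrow> real^'d^'m \<Rightarrow> 'l + 'm \<Rightarrow> real^'d" where
  "stacked_rows C A = case_sum (\<lambda>i. C $ i) (\<lambda>j. A $ j)"

definition stacked_coeffs :: "real^'l \<Rightarrow> real^'m \<Rightarrow> 'l + 'm \<Rightarrow> real" where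
  "stacked_coeffs u v = case_sum (\<lambda>i. u $ i) (\<lambda>j. v $ j)"

lemma stacked_coeffs_zero: "stacked_coeffs 0 0 k = 0"
  by (cases k) (simp_all add: stacked_coeffs_def)

lemma stacked_coeffs_add:
  "stacked_coeffs (u + u') (v + v') k = stacked_coeffs u v k + stacked_coeffs u' v' k"
  by (cases k) (simp_all add: stacked_coeffs_def)

lemma stacked_coeffs_scaleR: "stacked_coeffs (s *\<^sub>R u) (s *\<^sub>R v) k = s * stacked_coeffs u v k"
  by (cases k) (simp_all add: stacked_coeffs_def)

lemma transpose_mult_eq_row_combination:
  fixes C :: "real^'d^'l"
  shows "transpose C *v u = (\<Sum>i\<in>UNIV. u $ i *\<^sub>R C $ i)"
  by (simp add: vec_eq_iff matrix_vector_mult_def transpose_def mult.commute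
    del: transpose_matrix_vector)

lemma stacked_combination:
  fixes C :: "real^'d^'l" and A :: "real^'d^'m"
  shows "transpose C *v u + transpose A *v v =
    (\<Sum>k\<in>UNIV. stacked_coeffs u v k *\<^sub>R stacked_rows C A k)"
  unfolding UNIV_Plus_UNIV[symmetric]
  by (simp add: sum.Plus transpose_mult_eq_row_combination stacked_coeffs_def stacked_rows_def o_def
    del: UNIV_Plus_UNIV transpose_matrix_vector)

lemma selected_rows_independent_iff:
  fixes C :: "real^'d^'l" and A :: "real^'d^'m"
  shows "selected_rows_independent C A u v \<longleftrightarrow>
    inj_on (stacked_rows C A) {k. stacked_coeffs u v k \<noteq> 0} \<and>
    independent (stacked_rows C A ` {k. stacked_coeffs u v k \<noteq> 0})"
proof -
  have "Inl ` {i. u $ i \<noteq> 0} \<union> Inr ` {j. v $ j \<noteq> 0} = {k. stacked_coeffs u v k \<noteq> 0}"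
  proof (rule set_eqI)
    fix k :: "'l + 'm"
    show "k \<in> Inl ` {i. u $ i \<noteq> 0} \<union> Inr ` {j. v $ j \<noteq> 0} \<longleftrightarrow> k \<in> {k. stacked_coeffs u v k \<noteq> 0}"
      by (cases k) (auto simp: stacked_coeffs_def)
  qed
  then show ?thesis by (simp add: selected_rows_independent_def stacked_rows_def Let_def)
qed

text \<open>This makes the supremum in the Hoffman constant finite. For a fixed support with independent rows,
  the multipliers depend injectively, hence boundedly, on the combination they produce; there are
  only finitely many supports.\<close>

lemma independent_rows_norm_bound:
  fixes C :: "real^'d^'l" and A :: "real^'d^'m"
  shows "\<exists>B. \<forall>u v. selected_rows_independent C A u v \<longrightarrow>
    norm (u, v) \<le> B * norm (transpose C *v u + transpose A *v v)"
proof -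
  define F :: "(real^'l) \<times> (real^'m) \<Rightarrow> real^'d"
    where "F p = transpose C *v fst p + transpose A *v snd p" for p
  define V where "V S = {p. \<forall>k. k \<notin> S \<longrightarrow> stacked_coeffs (fst p) (snd p) k = 0}" for S :: "('l + 'm) set"
  have lin: "bounded_linear F"
    unfolding F_def linear_conv_bounded_linear[symmetric]
    by (rule linearI) (simp_all add: matrix_vector_right_distrib matrix_vector_mult_scaleR
        scaleR_add_right del: transpose_matrix_vector)
  have sub: "subspace (V S)" for S
    unfolding V_def
    by (rule subspaceI) (auto simp: stacked_coeffs_zero stacked_coeffs_add stacked_coeffs_scaleR)
  have "\<exists>e>0. inj_on (stacked_rows C A) S \<and> independent (stacked_rows C A ` S) \<longrightarrow>
      (\<forall>p\<in>V S. e * norm p \<le> norm (F p))" for S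
  proof (cases "inj_on (stacked_rows C A) S \<and> independent (stacked_rows C A ` S)")
    case True
    have "\<forall>p\<in>V S. F p = 0 \<longrightarrow> p = 0"
    proof (intro ballI impI)
      fix p assume p: "p \<in> V S" "F p = 0"
      have "(\<Sum>k\<in>S. stacked_coeffs (fst p) (snd p) k *\<^sub>R stacked_rows C A k) = F p"
        unfolding F_def stacked_combination
        using p(1) by (intro sum.mono_neutral_left) (auto simp: V_def)
      with p(2) have "\<forall>k\<in>S. stacked_coeffs (fst p) (snd p) k = 0"
        using True unfolding indexed_family_independent_iff[OF finite]
        by (elim allE[of _ "stacked_coeffs (fst p) (snd p)"]) simp
      with p(1) have 0: "stacked_coeffs (fst p) (snd p) k = 0" for k
        by (cases "k \<in> S") (auto simp: V_def)
      show "p = 0"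
        using 0[of "Inl _"] 0[of "Inr _"]
        by (simp add: stacked_coeffs_def prod_eq_iff vec_eq_iff)
    qed
    from injective_imp_isometric[OF closed_subspace[OF sub] sub lin this]
    show ?thesis by blast
  qed (auto intro: exI[of _ 1])
  then obtain e where e: "\<And>S. 0 < e S"
    "\<And>S p. inj_on (stacked_rows C A) S \<Longrightarrow> independent (stacked_rows C A ` S) \<Longrightarrow> p \<in> V S \<Longrightarrow>
      e S * norm p \<le> norm (F p)"
    by metis
  define B where "B = Max (range (\<lambda>S. 1 / e S))"
  show ?thesis
  proof (intro exI[of _ B] allI impI)
    fix u v assume ind: "selected_rows_independent C A u v"
    let ?S = "{k. stacked_coeffs u v k \<noteq> 0}"
    have "e ?S * norm (u, v) \<le> norm (F (u, v))"
      using ind by (intro e(2)) (auto simp: selected_rows_independent_iff V_def)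
    then have "norm (u, v) \<le> 1 / e ?S * norm (F (u, v))"
      using e(1)[of ?S] by (simp add: field_simps del: transpose_matrix_vector)
    also have "\<dots> \<le> B * norm (F (u, v))"
      unfolding B_def by (intro mult_right_mono Max_ge) auto
    finally show "norm (u, v) \<le> B * norm (transpose C *v u + transpose A *v v)"
      by (simp add: F_def)
  qed
qed

text \<open>The Hoffman constant measures multipliers of unit combinations; homogeneity extends the bound to
  all combinations.\<close>

lemma norm_multipliers_le_hoffman_constant:
  fixes C :: "real^'d^'l" and A :: "real^'d^'m"
  assumes u: "0 \<le> u" and ind: "selected_rows_independent C A u v"
  shows "norm (u, v) \<le> hoffman_constant C A * norm (transpose C *v u + transpose A *v v)"
proof -
  let ?H = "{norm (u, v) | u v. 0 \<le> u \<and> norm (transpose C *v u + transpose A *v v) = 1 \<and>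
                             selected_rows_independent C A u v}"
  obtain B where B: "\<And>u v. selected_rows_independent C A u v \<Longrightarrow>
    norm (u, v) \<le> B * norm (transpose C *v u + transpose A *v v)"
    using independent_rows_norm_bound[of C A] by blast
  have bdd: "bdd_above ?H"
  proof (rule bdd_aboveI)
    fix x assume "x \<in> ?H"
    then obtain u v where uv: "x = norm (u, v)" "selected_rows_independent C A u v"
      "norm (transpose C *v u + transpose A *v v) = 1" by blast
    from B[OF uv(2)] show "x \<le> B" by (simp only: uv(1,3) mult_1_right)
  qed
  define s where "s = norm (transpose C *v u + transpose A *v v)"
  show ?thesis
  proof (cases "s = 0")
    case True
    then show ?thesis using B[OF ind] by (simp add: s_def del: transpose_matrix_vector)
  next
    case False
    then have s: "s > 0" by (simp add: s_def)
    have "stacked_coeffs ((1 / s) *\<^sub>R u) ((1 / s) *\<^sub>R v) k \<noteq> 0 \<longleftrightarrow> stacked_coeffs u v k \<noteq> 0" for k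
      using s by (simp add: stacked_coeffs_scaleR)
    with ind have ind': "selected_rows_independent C A ((1 / s) *\<^sub>R u) ((1 / s) *\<^sub>R v)"
      by (simp add: selected_rows_independent_iff)
    have "transpose C *v ((1 / s) *\<^sub>R u) + transpose A *v ((1 / s) *\<^sub>R v) =
        (1 / s) *\<^sub>R (transpose C *v u + transpose A *v v)"
      by (simp add: matrix_vector_mult_scaleR scaleR_add_right del: transpose_matrix_vector)
    then have unit: "norm (transpose C *v ((1 / s) *\<^sub>R u) + transpose A *v ((1 / s) *\<^sub>R v)) = 1"
      using s by (simp add: s_def[symmetric] del: transpose_matrix_vector)
    have "0 \<le> (1 / s) *\<^sub>R u" using u s by (simp add: less_eq_vec_def)
    with ind' unit have "norm ((1 / s) *\<^sub>R u, (1 / s) *\<^sub>R v) \<in> ?H" by blast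
    then have "norm ((1 / s) *\<^sub>R u, (1 / s) *\<^sub>R v) \<le> hoffman_constant C A"
      unfolding hoffman_constant_def by (rule cSup_upper[OF _ bdd])
    moreover have "norm ((1 / s) *\<^sub>R u, (1 / s) *\<^sub>R v) = norm (u, v) / s"
      using norm_scaleR[of "1 / s" "(u, v)"] s by simp
    ultimately show ?thesis using s by (simp add: s_def[symmetric] field_simps del: transpose_matrix_vector)
  qed
qed

text \<open>Hoffman's error bound. At the projection \<^term>\<open>p\<close> of \<^term>\<open>w\<close> the residual vector
  \<^term>\<open>g = w - p\<close> is normal to the polyhedron, hence a combination of the active inequality rows
  (with non-negative multipliers) and of the equality rows, and the rows can be taken independent.
  Pairing this combination with \<^term>\<open>g\<close> turns \<^term>\<open>(norm g)\<^sup>2\<close> into multipliers times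
  constraint violations at \<^term>\<open>w\<close>, and the multipliers have norm at most the Hoffman constant
  times \<^term>\<open>norm g\<close>.\<close>

theorem hoffman_error_bound:
  fixes C :: "real^'d^'l" and A :: "real^'d^'m" and b :: "real^'l" and a :: "real^'m"
    and w :: "real^'d"
  defines "P \<equiv> {w. C *v w \<le> b \<and> A *v w = a}"
  assumes nonempty: "P \<noteq> {}"
  shows "norm (w - closest_point P w) \<le>
    hoffman_constant C A * norm (\<chi> i. max 0 ((C *v w - b) $ i), A *v w - a)"
proof -
  have mult: "(C *v x) $ i = C $ i \<bullet> x" for x i
    by (simp add: matrix_mult_dot)
  have multA: "(A *v x) $ i = A $ i \<bullet> x" for x i
    by (simp add: matrix_mult_dot)
  have P_eq: "P = (\<Inter>i. {x. C $ i \<bullet> x \<le> b $ i}) \<inter> (\<Inter>j. {x. A $ j \<bullet> x = a $ j})"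
    by (auto simp: P_def less_eq_vec_def vec_eq_iff mult multA)
  have cl: "closed P" unfolding P_eq
    by (intro closed_Int closed_INT ballI closed_halfspace_le closed_hyperplane)
  have conv: "convex P" unfolding P_eq
    by (intro convex_Int convex_INT convex_halfspace_le convex_hyperplane)
  define p where "p = closest_point P w"
  have p: "p \<in> P" unfolding p_def by (rule closest_point_in_set[OF cl nonempty])
  define g where "g = w - p"
  define I where "I = {i. (C *v p) $ i = b $ i}"
  \<comment> \<open>A direction allowed by the active constraints keeps \<^term>\<open>p\<close> feasible for a small step,
    since the inactive ones have positive slack; then it cannot lead closer to \<^term>\<open>w\<close>.\<close>
  have polar: "g \<bullet> d \<le> 0"
    if dI: "\<And>i. i \<in> I \<Longrightarrow> C $ i \<bullet> d \<le> 0" and dA: "\<And>j. A $ j \<bullet> d = 0" for d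
  proof -
    define slack where "slack i = b $ i - C $ i \<bullet> p" for i
    define T where "T = insert 1 ((\<lambda>i. slack i / (1 + \<bar>C $ i \<bullet> d\<bar>)) ` (- I))"
    define t where "t = Min T"
    have slack: "slack i > 0" if "i \<notin> I" for i
      using p that by (auto simp: P_def I_def slack_def less_eq_vec_def mult less_le)
    have "finite T" "T \<noteq> {}" by (auto simp: T_def)
    then have t: "t > 0" using slack unfolding t_def by (subst Min_gr_iff) (auto simp: T_def add_pos_nonneg)
    have "C $ i \<bullet> (p + t *\<^sub>R d) \<le> b $ i" for i
    proof (cases "i \<in> I")
      case True
      then have "t * (C $ i \<bullet> d) \<le> 0" using dI t by (simp add: mult_nonneg_nonpos)
      then show ?thesis using True by (simp add: inner_add_right I_def mult)
    next
      case False
      have pos: "0 < 1 + \<bar>C $ i \<bullet> d\<bar>" by (simp add: add_pos_nonneg)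
      have "t \<le> slack i / (1 + \<bar>C $ i \<bullet> d\<bar>)"
        using False \<open>finite T\<close> unfolding t_def by (intro Min_le) (auto simp: T_def)
      with pos have "t * (1 + \<bar>C $ i \<bullet> d\<bar>) \<le> slack i" by (simp add: pos_le_divide_eq)
      moreover have "t * (C $ i \<bullet> d) \<le> t * (1 + \<bar>C $ i \<bullet> d\<bar>)"
        using t by (intro mult_left_mono) auto
      ultimately show ?thesis by (simp add: inner_add_right slack_def)
    qed
    then have "p + t *\<^sub>R d \<in> P"
      using p dA by (simp add: P_eq inner_add_right)
    from closest_point_dot[OF conv cl this, of w] have "t * (g \<bullet> d) \<le> 0"
      by (simp add: p_def[symmetric] g_def)
    then show ?thesis using t by (simp add: mult_le_0_iff)
  qed
  obtain c where c: "g = (\<Sum>k\<in>UNIV. c k *\<^sub>R stacked_rows C A k)"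
    "\<And>k. k \<in> Inl ` I \<Longrightarrow> 0 \<le> c k" "\<And>k. k \<notin> Inl ` I \<union> range Inr \<Longrightarrow> c k = 0"
  proof (rule farkas[of "Inl ` I" "range Inr" "stacked_rows C A" g])
    show "g \<bullet> d \<le> 0" if "\<forall>k\<in>Inl ` I. stacked_rows C A k \<bullet> d \<le> 0"
      "\<forall>k\<in>range Inr. stacked_rows C A k \<bullet> d = 0" for d
      using that by (intro polar) (auto simp: stacked_rows_def)
  qed auto
  obtain c' where c': "(\<Sum>k\<in>UNIV. c' k *\<^sub>R stacked_rows C A k) = g"
    "\<And>k. 0 \<le> c k \<Longrightarrow> 0 \<le> c' k" "\<And>k. c k = 0 \<Longrightarrow> c' k = 0"
    "inj_on (stacked_rows C A) {k. c' k \<noteq> 0}" "independent (stacked_rows C A ` {k. c' k \<noteq> 0})"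
    using sign_preserving_independent_support[where c = c and r = "stacked_rows C A"] c(1) by auto
  define u :: "real^'l" where "u = (\<chi> i. c' (Inl i))"
  define v :: "real^'m" where "v = (\<chi> j. c' (Inr j))"
  have coeffs: "stacked_coeffs u v = c'"
    by (rule ext) (auto simp: stacked_coeffs_def u_def v_def split: sum.splits)
  have u_inactive: "u $ i = 0" if "i \<notin> I" for i
    using that c(3)[of "Inl i"] c'(3)[of "Inl i"] by (auto simp: u_def)
  have u_nonneg: "0 \<le> u $ i" for i
  proof (cases "i \<in> I")
    case True
    then show ?thesis using c(2)[of "Inl i"] c'(2)[of "Inl i"] by (simp add: u_def)
  qed (simp add: u_inactive)
  have g_eq: "g = transpose C *v u + transpose A *v v"
    using c'(1) by (simp only: stacked_combination coeffs)
  have "norm (u, v) \<le> hoffman_constant C A * norm g"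
    unfolding g_eq
  proof (rule norm_multipliers_le_hoffman_constant)
    show "0 \<le> u" using u_nonneg by (simp add: less_eq_vec_def)
    show "selected_rows_independent C A u v"
      using c'(4,5) by (simp add: selected_rows_independent_iff coeffs)
  qed
  let ?res = "(\<chi> i. max 0 ((C *v w - b) $ i), A *v w - a)"
  have "g \<bullet> g = u \<bullet> (C *v g) + v \<bullet> (A *v g)"
    by (subst g_eq) (simp add: inner_add_left dot_lmul_matrix[symmetric])
  also have "\<dots> \<le> (u, v) \<bullet> ?res"
  proof -
    have "u \<bullet> (C *v g) \<le> u \<bullet> (\<chi> i. max 0 ((C *v w - b) $ i))"
      unfolding inner_vec_def
    proof (rule sum_mono)
      fix i
      have "u $ i * (C *v g) $ i \<le> u $ i * max 0 ((C *v w - b) $ i)"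
      proof (cases "i \<in> I")
        case True
        then show ?thesis using u_nonneg
          by (intro mult_left_mono) (auto simp: g_def I_def matrix_vector_mult_diff_distrib)
      qed (simp add: u_inactive)
      then show "u $ i \<bullet> (C *v g) $ i \<le> u $ i \<bullet> (\<chi> i. max 0 ((C *v w - b) $ i)) $ i" by simp
    qed
    moreover have "A *v g = A *v w - a"
      using p by (simp add: g_def P_def matrix_vector_mult_diff_distrib)
    ultimately show ?thesis by simp
  qed
  also have "\<dots> \<le> norm (u, v) * norm ?res" by (rule norm_cauchy_schwarz)
  also have "\<dots> \<le> hoffman_constant C A * norm g * norm ?res"
    by (rule mult_right_mono) (fact, simp)
  finally have "norm g * norm g \<le> norm g * (hoffman_constant C A * norm ?res)"
    by (simp add: dot_square_norm power2_eq_square mult_ac)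
  \<comment> \<open>At a feasible point both sides vanish, whatever the sign of the Hoffman constant may be:
    for zero matrices it is the supremum of the empty set.\<close>
  show ?thesis
  proof (cases "g = 0")
    case False
    with \<open>norm g * norm g \<le> _\<close> show ?thesis by (simp add: g_def p_def)
  next
    case True
    then have "w \<in> P" using p by (simp add: g_def)
    then have "?res = 0"
      by (auto simp: P_def less_eq_vec_def vec_eq_iff prod_eq_iff)
    moreover have "w - closest_point P w = 0" using True by (simp only: g_def p_def)
    ultimately show ?thesis by (simp only: norm_zero mult_zero_right order_refl)
  qed
qed

section \<open>Growth of a composite objective at a minimiser\<close>

lemma gderiv_gradient:
  fixes F :: "'a::euclidean_space \<Rightarrow> real"
  assumes "F differentiable (at x)"
  shows "GDERIV F x :> gradient F x"
proof -
  obtain D where D: "(F has_derivative D) (at x)" using assms by (auto simp: differentiable_def)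
  have "linear D" using D has_derivative_linear by blast
  from adjoint_works[OF this, of _ 1] have D_eq: "D = (\<lambda>d. d \<bullet> adjoint D 1)" by auto
  have ex: "GDERIV F x :> adjoint D 1" using D D_eq by (simp add: gderiv_def)
  have "E = adjoint D 1" if "GDERIV F x :> E" for E
  proof -
    have "(\<lambda>d. d \<bullet> E) = (\<lambda>d. d \<bullet> adjoint D 1)"
      using that ex unfolding gderiv_def by (rule has_derivative_unique)
    then have "\<forall>d. d \<bullet> E = d \<bullet> adjoint D 1" by metis
    then show ?thesis by (simp add: vector_eq_ldot)
  qed
  with ex show ?thesis unfolding gradient_def by (rule theI)
qed

lemma derivative_nonneg_at_minimum:
  fixes f :: "'a::real_normed_vector \<Rightarrow> real"
  assumes "convex W" "w0 \<in> W" "w \<in> W" and min: "\<And>v. v \<in> W \<Longrightarrow> f w0 \<le> f v"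
    and D: "(f has_derivative D) (at w0)"
  shows "0 \<le> D (w - w0)"
proof (rule ccontr)
  assume neg: "\<not> 0 \<le> D (w - w0)"
  define \<phi> where "\<phi> t = f (w0 + t *\<^sub>R (w - w0))" for t
  have D0: "(f has_derivative D) (at (w0 + 0 *\<^sub>R (w - w0)))" using D by simp
  have "(\<phi> has_derivative (\<lambda>t. D (t *\<^sub>R (w - w0)))) (at 0)"
    unfolding \<phi>_def
    by (rule has_derivative_compose[where f = "\<lambda>t. w0 + t *\<^sub>R (w - w0)" and g = f, OF _ D0])
      (auto intro!: derivative_eq_intros)
  moreover have "(\<lambda>t. D (t *\<^sub>R (w - w0))) = (*) (D (w - w0))"
    using has_derivative_linear[OF D] by (auto simp: linear_scale)
  ultimately have "(\<phi> has_real_derivative D (w - w0)) (at 0)"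
    by (simp add: has_field_derivative_def)
  from DERIV_neg_dec_right[OF this] neg obtain \<delta> where
    \<delta>: "\<delta> > 0" "\<And>t. 0 < t \<Longrightarrow> t < \<delta> \<Longrightarrow> \<phi> t < \<phi> 0" by auto
  define t where "t = min 1 (\<delta> / 2)"
  have t: "0 < t" "t \<le> 1" "t < \<delta>" using \<delta>(1) by (auto simp: t_def)
  have "(1 - t) *\<^sub>R w0 + t *\<^sub>R w \<in> W"
    using assms(1-3) t by (intro convexD_alt) auto
  moreover have "(1 - t) *\<^sub>R w0 + t *\<^sub>R w = w0 + t *\<^sub>R (w - w0)" by (simp add: algebra_simps)
  ultimately have "f w0 \<le> \<phi> t" using min by (simp add: \<phi>_def)
  with \<delta>(2)[OF t(1,3)] show False by (simp add: \<phi>_def)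
qed

text \<open>Strong convexity of the outer function controls only the image under \<^term>\<open>X\<close>. The quantity
  \<^term>\<open>G\<close> is the directional derivative of \<^term>\<open>f\<close> at the minimiser; it is kept explicit, instead of
  being dropped as non-negative, because it later controls the linear part \<^term>\<open>q\<close>.\<close>

lemma strongly_convex_composite_growth:
  fixes X :: "real^'d^'n" and H :: "real^'n \<Rightarrow> real" and q :: "real^'d"
  defines "f \<equiv> \<lambda>w. H (X *v w) + q \<bullet> w"
  assumes W: "convex W" "w0 \<in> W" "w \<in> W" and min: "\<And>v. v \<in> W \<Longrightarrow> f w0 \<le> f v"
    and diff: "H differentiable (at (X *v w0))"
    and sc: "strongly_convex_on U H \<mu>" and U: "X *v w0 \<in> U" "X *v w \<in> U"
  defines "G \<equiv> gradient H (X *v w0) \<bullet> (X *v w - X *v w0) + q \<bullet> (w - w0)"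
  shows "0 \<le> G" "G + \<mu> / 2 * (norm (X *v w - X *v w0))\<^sup>2 \<le> f w - f w0"
proof -
  have H: "(H has_derivative (\<lambda>d. d \<bullet> gradient H (X *v w0))) (at (X *v w0))"
    using gderiv_gradient[OF diff] by (simp add: gderiv_def)
  have "((\<lambda>w. X *v w) has_derivative (\<lambda>d. X *v d)) (at w0)"
    by (intro bounded_linear_imp_has_derivative) (simp add: linear_conv_bounded_linear[symmetric])
  from has_derivative_compose[OF this H]
  have "(f has_derivative (\<lambda>d. (X *v d) \<bullet> gradient H (X *v w0) + q \<bullet> d)) (at w0)"
    unfolding f_def by (intro has_derivative_add has_derivative_inner_right has_derivative_ident)
  from derivative_nonneg_at_minimum[OF W min this]
  show "0 \<le> G" by (simp add: G_def inner_commute matrix_vector_mult_diff_distrib)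
  have "H (X *v w0) + gradient H (X *v w0) \<bullet> (X *v w - X *v w0)
      + \<mu> / 2 * (norm (X *v w - X *v w0))\<^sup>2 \<le> H (X *v w)"
    using sc U unfolding strongly_convex_on_def by blast
  then show "G + \<mu> / 2 * (norm (X *v w - X *v w0))\<^sup>2 \<le> f w - f w0"
    by (simp add: f_def G_def inner_diff_right)
qed

text \<open>A convex function that grows at least by \<^term>\<open>\<mu> / 2\<close> from its minimum up to image distance 1
  grows at least linearly beyond, so an upper bound on its values bounds the image.\<close>

lemma bounded_image_of_bounded_values:
  fixes X :: "real^'d^'n" and H :: "real^'n \<Rightarrow> real" and q :: "real^'d"
  defines "f \<equiv> \<lambda>w. H (X *v w) + q \<bullet> w"
  assumes W: "convex W" "w0 \<in> W" "w \<in> W" and min: "\<And>v. v \<in> W \<Longrightarrow> f w0 \<le> f v"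
    and cvx: "convex_on W f"
    and diff: "H differentiable (at (X *v w0))"
    and sc: "strongly_convex_on (range ((*v) X) \<inter> cball (X *v w0) 1) H \<mu>"
    and M: "f w - f w0 \<le> M"
  shows "norm (X *v w - X *v w0) \<le> max 1 (2 * M / \<mu>)"
proof (cases "norm (X *v w - X *v w0) \<le> 1")
  case False
  \<comment> \<open>The segment from \<^term>\<open>w0\<close> to \<^term>\<open>w\<close> is cut where its image leaves the unit ball.\<close>
  define R where "R = norm (X *v w - X *v w0)"
  have R: "R > 1" using False by (simp add: R_def)
  define t where "t = 1 / R"
  have t: "0 < t" "t \<le> 1" using R by (auto simp: t_def)
  define v where "v = (1 - t) *\<^sub>R w0 + t *\<^sub>R w"
  have vW: "v \<in> W" unfolding v_def using W t by (intro convexD_alt) auto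
  have "X *v v - X *v w0 = t *\<^sub>R (X *v w - X *v w0)"
    by (simp add: v_def matrix_vector_right_distrib matrix_vector_mult_scaleR algebra_simps)
  then have dist: "norm (X *v v - X *v w0) = 1" using R by (simp add: R_def[symmetric] t_def)
  have \<mu>: "\<mu> > 0" using sc by (simp add: strongly_convex_on_def)
  have "X *v v \<in> range ((*v) X) \<inter> cball (X *v w0) 1"
    using dist by (simp add: dist_norm norm_minus_commute)
  moreover have "X *v w0 \<in> range ((*v) X) \<inter> cball (X *v w0) 1" by simp
  ultimately have "\<mu> / 2 \<le> f v - f w0"
    using strongly_convex_composite_growth[OF W(1,2) vW min[unfolded f_def] diff sc] dist
    by (simp add: f_def)
  also have "f v \<le> (1 - t) * f w0 + t * f w"
    unfolding v_def using convex_onD[OF cvx] W t by simp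
  then have "f v - f w0 \<le> t * (f w - f w0)" by (simp add: algebra_simps)
  also have "\<dots> \<le> t * M" using M t by (intro mult_left_mono) auto
  finally have "R \<le> 2 * M / \<mu>" using R \<mu> by (simp add: t_def field_simps)
  then show ?thesis by (simp add: R_def)
qed simp

lemma convex_smooth_average:
  assumes "smooth_convex_average f (fs :: 'n::finite \<Rightarrow> 'a::euclidean_space \<Rightarrow> real) L Ls"
  shows "convex_on UNIV f"
proof -
  have "convex_on UNIV (\<lambda>w. \<Sum>i\<in>I. fs i w)" if "finite I" for I
    using that
  proof (induction I)
    case empty
    then show ?case by (simp add: convex_on_def)
  next
    case (insert i I)
    have "convex_on UNIV (fs i)" using assms by (simp add: smooth_convex_average_def)
    from convex_on_add[OF this insert.IH] show ?case using insert.hyps by simp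
  qed
  from this[OF finite] have "convex_on UNIV (\<lambda>w. (\<Sum>i\<in>UNIV. fs i w) / real CARD('n))"
    by (rule convex_on_cdiv[rotated]) simp
  also have "(\<lambda>w. (\<Sum>i\<in>UNIV. fs i w) / real CARD('n)) = f"
    using assms by (auto simp: smooth_convex_average_def)
  finally show ?thesis .
qed

section \<open>The semi-strongly convex inequality\<close>

lemma norm_append_row_residual:
  fixes X :: "real^'d^'n" and q w w0 :: "real^'d"
  shows "(norm (append_row X q *v w - append_row X q *v w0))\<^sup>2 =
    (norm (X *v w - X *v w0))\<^sup>2 + (q \<bullet> (w - w0))\<^sup>2"
proof -
  have "(append_row X q *v w - append_row X q *v w0) $ None = q \<bullet> (w - w0)"
    and "\<And>i. (append_row X q *v w - append_row X q *v w0) $ Some i = (X *v w - X *v w0) $ i"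
    by (simp_all add: append_row_def matrix_mult_dot inner_diff_right)
  then show ?thesis
    by (simp add: norm_vec_def L2_set_def sum_nonneg UNIV_option_conv sum.reindex
        del: vector_minus_component)
qed

lemma append_row_eq_iff:
  fixes X :: "real^'d^'n" and q w w0 :: "real^'d"
  shows "append_row X q *v w = append_row X q *v w0 \<longleftrightarrow> X *v w = X *v w0 \<and> q \<bullet> w = q \<bullet> w0"
proof -
  have "append_row X q *v w = append_row X q *v w0 \<longleftrightarrow>
      (norm (append_row X q *v w - append_row X q *v w0))\<^sup>2 = 0" by simp
  also have "\<dots> \<longleftrightarrow> X *v w - X *v w0 = 0 \<and> q \<bullet> (w - w0) = 0"
    unfolding norm_append_row_residual by (simp add: add_nonneg_eq_0_iff)
  finally show ?thesis by (simp add: inner_diff_right)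
qed

text \<open>The numerical heart of the estimate, where \<^term>\<open>R\<close> and \<^term>\<open>s\<close> stand for the residuals of the
  equations for \<^term>\<open>X\<close> and \<^term>\<open>q\<close>, \<^term>\<open>\<Delta>\<close> for the optimality gap and \<^term>\<open>G\<close> for the
  directional derivative. The linear residual \<^term>\<open>s\<close> is \<^term>\<open>G\<close> up to an error proportional to
  \<^term>\<open>R\<close>. The square of \<^term>\<open>G\<close> would be of second order in the gap; one factor is traded for
  the bound \<^term>\<open>M\<close>.\<close>

lemma residual_bound:
  fixes G \<Delta> R s \<gamma> \<mu> M :: real
  assumes \<mu>: "\<mu> > 0" and G: "0 \<le> G" and growth: "G + \<mu> / 2 * R\<^sup>2 \<le> \<Delta>" and M: "\<Delta> \<le> M"
    and s: "\<bar>s - G\<bar> \<le> \<gamma> * R"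
  shows "R\<^sup>2 + s\<^sup>2 \<le> 2 * \<Delta> * ((1 + 2 * \<gamma>\<^sup>2) / \<mu> + M)"
proof -
  have R2: "R\<^sup>2 \<le> 2 * \<Delta> / \<mu>" using \<mu> G growth by (simp add: field_simps)
  have "G \<le> \<Delta>" using growth \<mu> by (smt (verit) mult_nonneg_nonneg zero_le_power2 divide_nonneg_pos)
  then have G2: "G\<^sup>2 \<le> \<Delta> * M"
    unfolding power2_eq_square using G M by (intro mult_mono) auto
  have "(s - G)\<^sup>2 \<le> (\<gamma> * R)\<^sup>2" using power_mono[OF s, of 2] by simp
  moreover have "s\<^sup>2 \<le> 2 * G\<^sup>2 + 2 * (s - G)\<^sup>2"
    using zero_le_power2[of "s - 2 * G"] by (simp add: power2_eq_square algebra_simps)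
  ultimately have "R\<^sup>2 + s\<^sup>2 \<le> (1 + 2 * \<gamma>\<^sup>2) * R\<^sup>2 + 2 * G\<^sup>2"
    by (simp add: power_mult_distrib algebra_simps)
  also have "\<dots> \<le> (1 + 2 * \<gamma>\<^sup>2) * (2 * \<Delta> / \<mu>) + 2 * (\<Delta> * M)"
    using R2 G2 by (intro add_mono mult_left_mono) auto
  also have "\<dots> = 2 * \<Delta> * ((1 + 2 * \<gamma>\<^sup>2) / \<mu> + M)"
    by (simp add: algebra_simps add_divide_distrib)
  finally show ?thesis .
qed

theorem lemma1:
  fixes X :: "real^'d^'n" and q :: "real^'d" and C :: "real^'d^'l" and b :: "real^'l"
    and h :: "real^'n \<Rightarrow> ereal" and f :: "real^'d \<Rightarrow> real"
    and fs :: "'n \<Rightarrow> real^'d \<Rightarrow> real" and L :: real and Ls :: "'n \<Rightarrow> real"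
    and W Wopt :: "(real^'d) set" and fopt :: real and ropt :: "real^'n"
    and \<theta> M :: real
  assumes f: "\<forall>w. ereal (f w) = h (X *v w) + ereal (q \<bullet> w)"
    and A1: "smooth_convex_average f fs L Ls"
    and A2: "locally_strongly_convex h"
    and W: "W = polyhedral_set C b"
    and Wopt: "Wopt = solution_set f W"
    and A3: "Wopt \<noteq> {}"
    and fopt: "fopt = Inf (f ` W)"
    and ropt: "ropt = (THE r. \<forall>w\<in>Wopt. X *v w = r)"
    and theta: "\<theta> = hoffman_constant C (append_row X q)" "\<theta> > 0"
    and M: "M > 0" "\<forall>w\<in>W. f w - fopt \<le> M"
  shows "(\<exists>U. convex U \<and> compact U \<and> U \<subseteq> effective_domain h \<and> (\<lambda>w. X *v w) ` W \<subseteq> U) \<and>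
    (\<forall>U \<mu>. convex U \<and> compact U \<and> U \<subseteq> effective_domain h \<and> (\<lambda>w. X *v w) ` W \<subseteq> U \<and>
       strongly_convex_on U (\<lambda>r. real_of_ereal (h r)) \<mu> \<longrightarrow>
       (let \<beta> = 1 / (\<theta>\<^sup>2 * ((1 + 2 * (norm (gradient (\<lambda>r. real_of_ereal (h r)) ropt))\<^sup>2) / \<mu> + M))
        in \<beta> > 0 \<and>
           (\<forall>w\<in>W. f w - fopt \<ge> \<beta> / 2 * (norm (w - closest_point Wopt w))\<^sup>2)))"
proof -
  define H where "H r = real_of_ereal (h r)" for r
  have dom: "X *v w \<in> effective_domain h" for w
    using f[rule_format, of w] by (cases "h (X *v w)") (auto simp: effective_domain_def)
  have f_eq: "f = (\<lambda>w. H (X *v w) + q \<bullet> w)"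
  proof
    fix w
    show "f w = H (X *v w) + q \<bullet> w"
      using f[rule_format, of w] by (cases "h (X *v w)") (auto simp: H_def)
  qed
  have diff: "H differentiable (at (X *v w))" for w
    using A2 dom[of w] unfolding locally_strongly_convex_def H_def by blast
  have sc_ex: "\<exists>\<mu>. strongly_convex_on U H \<mu>"
    if "convex U" "compact U" "U \<subseteq> effective_domain h" for U
    using A2 that unfolding locally_strongly_convex_def H_def by blast
  have W_eq: "W = (\<Inter>i. {w. C $ i \<bullet> w \<le> b $ i})"
    by (auto simp: W polyhedral_set_def less_eq_vec_def matrix_mult_dot)
  have convW: "convex W" unfolding W_eq by (intro convex_INT convex_halfspace_le)
  obtain w0 where "w0 \<in> Wopt" using A3 by blast
  then have w0: "w0 \<in> W" and min: "\<And>v. v \<in> W \<Longrightarrow> f w0 \<le> f v"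
    by (auto simp: Wopt solution_set_def is_arg_min_def not_less)
  have Wopt_iff: "w \<in> Wopt \<longleftrightarrow> w \<in> W \<and> f w = f w0" for w
    using w0 min by (fastforce simp: Wopt solution_set_def is_arg_min_def not_less)
  have fopt_eq: "fopt = f w0"
    unfolding fopt using w0 min by (intro cInf_eq_minimum) auto
  have growth: "0 \<le> gradient H (X *v w0) \<bullet> (X *v w - X *v w0) + q \<bullet> (w - w0)"
    "gradient H (X *v w0) \<bullet> (X *v w - X *v w0) + q \<bullet> (w - w0)
      + \<mu> / 2 * (norm (X *v w - X *v w0))\<^sup>2 \<le> f w - f w0"
    if "w \<in> W" "X *v w0 \<in> U" "X *v w \<in> U" "strongly_convex_on U H \<mu>" for w U \<mu>
    using strongly_convex_composite_growth[OF convW w0 that(1) min[unfolded f_eq] diff that(4,2,3)]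
    by (simp_all add: f_eq)

  \<comment> \<open>As \<^term>\<open>f\<close> is finite everywhere, the whole range of \<^term>\<open>X\<close> lies in the effective domain, so
    its intersection with a ball of any radius is an admissible compact set.\<close>
  have slice: "convex (range ((*v) X) \<inter> cball (X *v w0) \<rho>)"
    "compact (range ((*v) X) \<inter> cball (X *v w0) \<rho>)"
    "range ((*v) X) \<inter> cball (X *v w0) \<rho> \<subseteq> effective_domain h" for \<rho>
  proof -
    have "subspace (range ((*v) X))" by (intro linear_subspace_image) auto
    then show "convex (range ((*v) X) \<inter> cball (X *v w0) \<rho>)"
      "compact (range ((*v) X) \<inter> cball (X *v w0) \<rho>)"
      by (simp_all add: convex_Int closed_Int_compact subspace_imp_convex closed_subspace)
  qed (use dom in auto)
  obtain U0 where U0: "convex U0" "compact U0" "U0 \<subseteq> effective_domain h" "(\<lambda>w. X *v w) ` W \<subseteq> U0"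
  proof -
    obtain \<mu> where \<mu>: "strongly_convex_on (range ((*v) X) \<inter> cball (X *v w0) 1) H \<mu>"
      using sc_ex[OF slice] by blast
    have cvx: "convex_on W f"
      using convex_on_subset[OF convex_smooth_average[OF A1]] convW by blast
    define \<rho> where "\<rho> = max 1 (2 * M / \<mu>)"
    have "norm (X *v w - X *v w0) \<le> \<rho>" if w: "w \<in> W" for w
      unfolding \<rho>_def
      using bounded_image_of_bounded_values[OF convW w0 w min[unfolded f_eq] cvx[unfolded f_eq] diff \<mu>]
        M(2) w by (simp add: fopt_eq f_eq)
    then have "(\<lambda>w. X *v w) ` W \<subseteq> range ((*v) X) \<inter> cball (X *v w0) \<rho>"
      by (auto simp: dist_norm norm_minus_commute)
    with slice show thesis by (rule that)
  qed

  \<comment> \<open>Two optimal points with different images would violate the quadratic growth.\<close>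
  have X_eq: "X *v w = X *v w0" if w: "w \<in> Wopt" for w
  proof -
    obtain \<mu> where \<mu>: "strongly_convex_on U0 H \<mu>" using sc_ex U0 by blast
    have "w \<in> W" "f w = f w0" using w by (auto simp: Wopt_iff)
    moreover have "X *v w0 \<in> U0" "X *v w \<in> U0" using U0(4) w0 \<open>w \<in> W\<close> by auto
    ultimately have "\<mu> / 2 * (norm (X *v w - X *v w0))\<^sup>2 \<le> 0"
      using growth[of w U0 \<mu>] \<mu> by linarith
    moreover have "\<mu> > 0" using \<mu> by (simp add: strongly_convex_on_def)
    ultimately show ?thesis by (simp add: mult_le_0_iff)
  qed
  have ropt_eq: "ropt = X *v w0"
    unfolding ropt
  proof (rule the_equality)
    show "\<forall>w\<in>Wopt. X *v w = X *v w0" using X_eq by blast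
  next
    fix r assume "\<forall>w\<in>Wopt. X *v w = r"
    then show "r = X *v w0" using \<open>w0 \<in> Wopt\<close> by simp
  qed
  have Wopt_eq: "Wopt = {w. C *v w \<le> b \<and> append_row X q *v w = append_row X q *v w0}"
  proof -
    have "w \<in> Wopt \<longleftrightarrow> w \<in> W \<and> X *v w = X *v w0 \<and> q \<bullet> w = q \<bullet> w0" for w
    proof
      assume w: "w \<in> Wopt"
      then have "H (X *v w) + q \<bullet> w = H (X *v w0) + q \<bullet> w0" "w \<in> W"
        by (simp_all add: Wopt_iff f_eq)
      with X_eq[OF w] show "w \<in> W \<and> X *v w = X *v w0 \<and> q \<bullet> w = q \<bullet> w0" by simp
    qed (simp add: Wopt_iff f_eq)
    then show ?thesis
      by (simp add: set_eq_iff append_row_eq_iff W polyhedral_set_def)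
  qed

  have "let \<beta> = 1 / (\<theta>\<^sup>2 * ((1 + 2 * (norm (gradient H ropt))\<^sup>2) / \<mu> + M))
      in \<beta> > 0 \<and> (\<forall>w\<in>W. f w - fopt \<ge> \<beta> / 2 * (norm (w - closest_point Wopt w))\<^sup>2)"
    if U: "(\<lambda>w. X *v w) ` W \<subseteq> U" and sc: "strongly_convex_on U H \<mu>" for U \<mu>
  proof -
    let ?g = "gradient H (X *v w0)"
    define K where "K = (1 + 2 * (norm ?g)\<^sup>2) / \<mu> + M"
    have \<mu>: "\<mu> > 0" using sc by (simp add: strongly_convex_on_def)
    have K: "K > 0" unfolding K_def using \<mu> M(1) by (intro add_nonneg_pos) auto
    have "1 / (\<theta>\<^sup>2 * K) / 2 * (norm (w - closest_point Wopt w))\<^sup>2 \<le> f w - f w0" if w: "w \<in> W" for w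
    proof -
      let ?A = "append_row X q"
      let ?D = "norm (w - closest_point Wopt w)"
      have "(\<chi> i. max 0 ((C *v w - b) $ i)) = 0"
        using w by (auto simp: W polyhedral_set_def less_eq_vec_def vec_eq_iff)
      then have "?D \<le> \<theta> * norm (?A *v w - ?A *v w0)"
        using hoffman_error_bound[of C b ?A "?A *v w0" w] \<open>w0 \<in> Wopt\<close>
        unfolding Wopt_eq theta(1) by (auto simp: norm_Pair)
      then have "?D\<^sup>2 \<le> (\<theta> * norm (?A *v w - ?A *v w0))\<^sup>2" by (intro power_mono) auto
      also have "\<dots> = \<theta>\<^sup>2 * ((norm (X *v w - X *v w0))\<^sup>2 + (q \<bullet> (w - w0))\<^sup>2)"
        by (simp add: power_mult_distrib norm_append_row_residual)
      also have "\<dots> \<le> \<theta>\<^sup>2 * (2 * (f w - f w0) * K)"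
        unfolding K_def
      proof (intro mult_left_mono residual_bound[OF \<mu>])
        have "X *v w0 \<in> U" "X *v w \<in> U" using U w w0 by auto
        from growth[OF w this sc]
        show "0 \<le> ?g \<bullet> (X *v w - X *v w0) + q \<bullet> (w - w0)"
          "?g \<bullet> (X *v w - X *v w0) + q \<bullet> (w - w0) + \<mu> / 2 * (norm (X *v w - X *v w0))\<^sup>2 \<le> f w - f w0" .
        show "f w - f w0 \<le> M" using M(2) w fopt_eq by auto
        show "\<bar>q \<bullet> (w - w0) - (?g \<bullet> (X *v w - X *v w0) + q \<bullet> (w - w0))\<bar>
            \<le> norm ?g * norm (X *v w - X *v w0)"
          using Cauchy_Schwarz_ineq2[of ?g "X *v w - X *v w0"] by simp
      qed simp
      finally show ?thesis using theta(2) K by (simp add: field_simps)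
    qed
    moreover have "1 / (\<theta>\<^sup>2 * K) > 0" using K theta(2) by simp
    ultimately show ?thesis
      unfolding Let_def ropt_eq fopt_eq K_def[symmetric] by blast
  qed
  with U0 show ?thesis unfolding H_def[abs_def] by blast
qed

end
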